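(* Let $a,b>0$ be real numbers with $a\ne b$, and let $A=A(a,b)$, $G=G(a,b)$, $L=L(a,b)$ be their arithmetic, geometric and logarithmic means. For any $t>0$ one has $$L^{2t}A^t+L^tG^{2t}>2A^tG^{2t}$$ and $$2L^tA^t+L^tG^t>3A^tG^t .$$
   Context: For positive reals $a\neq b$: $A(a,b)=\frac{a+b}{2}$, $G(a,b)=\sqrt{ab}$, and $L(a,b)=\frac{a-b}{\ln a-\ln b}$. *)

theory Defs
  imports Complex_Main
begin

definition arith_mean :: "real \<Rightarrow> real \<Rightarrow> real" where
  "arith_mean a b = (a + b) / 2"

definition geom_mean :: "real \<Rightarrow> real \<Rightarrow> real" where
  "geom_mean a b = sqrt (a * b)"

(* Only meaningful for distinct positive arguments; at a = b the value is 0, not the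
   continuous extension a. *)
definition log_mean :: "real \<Rightarrow> real \<Rightarrow> real" where
  "log_mean a b = (a - b) / (ln a - ln b)"

end

theory Submission
  imports Defs
begin

text \<open>
  Both inequalities follow by the arithmetic--geometric mean inequality from
  \<open>L\<^sup>3 > A * G\<^sup>2\<close>. With \<open>a = G * exp x\<close> and \<open>b = G * exp (- x)\<close> one has
  \<open>A = G * cosh x\<close> and \<open>L = G * sinh x / x\<close>, so this says \<open>x < sinh x / root 3 (cosh x)\<close>
  for \<open>x > 0\<close>. The two sides agree at \<open>0\<close>, and with \<open>u = cosh x powr (2/3)\<close> the right
  side has derivative \<open>(2 * u ^ 3 + 1) / (3 * u\<^sup>2) \<ge> 1\<close>.
\<close>

lemma cosh_mult_cube_less_sinh_cube:
  fixes x :: real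
  assumes "x > 0"
  shows "x ^ 3 * cosh x < sinh x ^ 3"
proof -
  \<comment> \<open>In this form \<open>y\<close> enters only linearly, so one differentiation
    removes it and leaves a function of \<open>cosh y\<close> alone.\<close>
  define f where "f = (\<lambda>y::real. sinh y * cosh y powr (- 1 / 3) - y)"
  have deriv: "\<exists>d. (f has_real_derivative d) (at y) \<and> d > 0" if "y > 0" for y
  proof (intro exI conjI)
    define c where "c = cosh y"
    \<comment> \<open>Chosen so that \<open>u ^ 3 = c\<^sup>2\<close>, which turns the derivative
      into a rational function of \<open>u\<close>.\<close>
    define u where "u = c powr (2 / 3)"
    have c: "c > 1"
      using cosh_real_strict_mono[of 0 y] that by (simp add: c_def)
    have u: "u > 1"
      using c by (simp add: u_def)
    have u3: "u ^ 3 = c\<^sup>2"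
      using c by (simp add: u_def powr_power)
    have powr_a: "c powr (- 1 / 3) = u / c"
      using c powr_diff[of c "2 / 3" 1] by (simp add: u_def)
    have "((\<lambda>y. cosh y powr (- 1 / 3)) has_real_derivative
        - 1 / 3 * c powr (- 1 / 3 - of_nat 1) * sinh y) (at y)"
      unfolding c_def using c by (intro DERIV_fun_powr) (auto simp: c_def intro!: derivative_eq_intros)
    also have "c powr (- 1 / 3 - of_nat 1) = u / c / c"
      using c powr_diff[of c "- 1 / 3" 1] powr_a by simp
    finally have deriv_powr: "((\<lambda>y. cosh y powr (- 1 / 3)) has_real_derivative
        - 1 / 3 * (u / c / c) * sinh y) (at y)" .
    show "(f has_real_derivative
        c * (u / c) + sinh y * (- 1 / 3 * (u / c / c) * sinh y) - 1) (at y)"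
      unfolding f_def
      by (rule deriv_powr derivative_eq_intros refl)+ (use powr_a in \<open>simp flip: c_def\<close>)
    have "c * (u / c) + sinh y * (- 1 / 3 * (u / c / c) * sinh y) - 1
        = u - u * (c\<^sup>2 - 1) / (3 * c\<^sup>2) - 1"
      using c sinh_square_eq[of y] by (simp add: c_def power2_eq_square)
    \<comment> \<open>Over the denominator \<open>3 * u\<^sup>2\<close> the numerator is
      \<open>2 * u ^ 3 - 3 * u\<^sup>2 + 1\<close>, which has a double root at \<open>u = 1\<close>,
      the value at \<open>y = 0\<close>.\<close>
    also have "\<dots> = (u - 1)\<^sup>2 * (2 * u + 1) / (3 * u\<^sup>2)"
      using u unfolding u3[symmetric] by (simp add: field_simps power2_eq_square power3_eq_cube)
    finally show "c * (u / c) + sinh y * (- 1 / 3 * (u / c / c) * sinh y) - 1 > 0"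
      using u by simp
  qed
  have "f 0 < f x"
  \<comment> \<open>The derivative vanishes at \<open>0\<close>, so positivity is available only in
    the open interval; continuity takes care of the endpoints.\<close>
  proof (rule DERIV_pos_imp_increasing_open[OF assms])
    show "\<exists>d. (f has_real_derivative d) (at y) \<and> d > 0" if "0 < y" "y < x" for y
      using deriv that by blast
    show "continuous_on {0..x} f"
      unfolding f_def by (intro continuous_intros) (auto simp: less_imp_neq[symmetric])
  qed
  then have "x < sinh x * cosh x powr (- 1 / 3)"
    by (simp add: f_def)
  then have "x ^ 3 < (sinh x * cosh x powr (- 1 / 3)) ^ 3"
    using assms by (intro power_strict_mono) auto
  also have "\<dots> = sinh x ^ 3 / cosh x"
    by (simp add: power_divide powr_power powr_minus_divide)
  finally show ?thesis
    by (simp add: field_simps)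
qed

lemma log_mean_commute: "log_mean a b = log_mean b a"
  unfolding log_mean_def by (metis minus_diff_eq minus_divide_divide)

lemma arith_geom_less_log_mean_cube:
  assumes "a > 0" "b > 0" "a \<noteq> b"
  shows "arith_mean a b * (geom_mean a b)\<^sup>2 < log_mean a b ^ 3"
    and "log_mean a b > 0"
proof -
  \<comment> \<open>All three means are symmetric, so it suffices to treat \<open>b < a\<close>,
    which makes \<open>x\<close> positive below.\<close>
  have *: "arith_mean a b * (geom_mean a b)\<^sup>2 < log_mean a b ^ 3 \<and> log_mean a b > 0"
    if "b > 0" "b < a" for a b
  proof -
    \<comment> \<open>On the logarithmic scale \<open>ln g\<close> is the midpoint of
      \<open>ln b\<close> and \<open>ln a\<close>, and \<open>x\<close> is the distance from it to
      either.\<close>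
    define x where "x = (ln a - ln b) / 2"
    define g where "g = geom_mean a b"
    have x: "x > 0"
      using that by (simp add: x_def)
    have g: "g > 0"
      using that by (simp add: g_def geom_mean_def)
    have ln_g: "ln g = (ln a + ln b) / 2"
      using that by (simp add: g_def geom_mean_def ln_sqrt ln_mult)
    have a: "a = g * exp x"
    proof -
      have "a = exp (ln g + x)"
        using that by (simp add: ln_g x_def flip: add_divide_distrib)
      then show ?thesis
        using g by (simp add: exp_add)
    qed
    have b: "b = g * exp (- x)"
    proof -
      have "b = exp (ln g - x)"
        using that by (simp add: ln_g x_def flip: diff_divide_distrib)
      then show ?thesis
        using g by (simp add: exp_diff exp_minus field_simps)
    qed
    have A: "arith_mean a b = g * cosh x"
      by (subst a, subst b) (simp add: arith_mean_def cosh_def field_simps)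
    have "ln a - ln b = 2 * x"
      by (simp add: x_def)
    then have "log_mean a b = (a - b) / (2 * x)"
      by (simp only: log_mean_def)
    also have "\<dots> = g * sinh x / x"
      by (subst a, subst b) (simp add: sinh_def field_simps)
    finally have L: "log_mean a b = g * sinh x / x" .
    have "cosh x < sinh x ^ 3 / x ^ 3"
      using cosh_mult_cube_less_sinh_cube[OF x] x by (simp add: field_simps)
    then have "g ^ 3 * cosh x < g ^ 3 * (sinh x ^ 3 / x ^ 3)"
      using g by (intro mult_strict_left_mono) auto
    then have "arith_mean a b * g\<^sup>2 < log_mean a b ^ 3"
      unfolding A L by (simp add: power_mult_distrib power_divide power2_eq_square power3_eq_cube mult_ac)
    moreover have "log_mean a b > 0"
      using g x by (simp add: L)
    ultimately show ?thesis
      by (simp add: g_def)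
  qed
  have "arith_mean a b = arith_mean b a" "geom_mean a b = geom_mean b a"
    by (simp_all add: arith_mean_def geom_mean_def ac_simps)
  then have "arith_mean a b * (geom_mean a b)\<^sup>2 < log_mean a b ^ 3 \<and> log_mean a b > 0"
    using *[of a b] *[of b a] assms log_mean_commute[of a b] by (cases a b rule: linorder_cases) auto
  then show "arith_mean a b * (geom_mean a b)\<^sup>2 < log_mean a b ^ 3" "log_mean a b > 0"
    by auto
qed

text \<open>After multiplication by \<open>r\<close> the right side contains
  \<open>p * r ^ 3\<close>. Replacing \<open>r ^ 3\<close> by the smaller
  \<open>p * q\<^sup>2\<close> leaves \<open>q\<^sup>2 * (p\<^sup>2 + r\<^sup>2)\<close>, which is
  at least \<open>2 * p * r * q\<^sup>2\<close>.\<close>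

lemma two_mult_less_of_mult_square_less_cube:
  fixes p q r :: real
  assumes "p > 0" "p * q\<^sup>2 < r ^ 3" "r > 0"
  shows "2 * p * q\<^sup>2 < r\<^sup>2 * p + r * q\<^sup>2"
proof -
  have "0 \<le> q\<^sup>2 * (p - r)\<^sup>2"
    by simp
  then have "r * (2 * p * q\<^sup>2) \<le> p * (p * q\<^sup>2) + r\<^sup>2 * q\<^sup>2"
    by (simp add: power2_eq_square algebra_simps)
  also have "\<dots> < p * r ^ 3 + r\<^sup>2 * q\<^sup>2"
    using assms by simp
  also have "\<dots> = r * (r\<^sup>2 * p + r * q\<^sup>2)"
    by (simp add: power2_eq_square power3_eq_cube algebra_simps)
  finally show ?thesis
    using assms by simp
qed

text \<open>After multiplication by \<open>r\<^sup>2\<close>, only the cube in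
  \<open>q * r ^ 3\<close> is replaced by \<open>p * q\<^sup>2\<close>. What remains is
  \<open>p\<close> times the AM-GM inequality for the cubes of \<open>r\<close>, \<open>r\<close>,
  \<open>q\<close>, in the form \<open>2 * r ^ 3 + q ^ 3 - 3 * r\<^sup>2 * q = (r - q)\<^sup>2 * (2
  * r + q)\<close>.\<close>

lemma three_mult_less_of_mult_square_less_cube:
  fixes p q r :: real
  assumes "p > 0" "q > 0" "r > 0" "p * q\<^sup>2 < r ^ 3"
  shows "3 * p * q < 2 * r * p + r * q"
proof -
  have "0 \<le> p * ((r - q)\<^sup>2 * (2 * r + q))"
    using assms by simp
  then have "r\<^sup>2 * (3 * p * q) \<le> 2 * r ^ 3 * p + q * (p * q\<^sup>2)"
    by (simp add: power2_eq_square power3_eq_cube algebra_simps)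
  also have "\<dots> < 2 * r ^ 3 * p + q * r ^ 3"
    using assms by simp
  also have "\<dots> = r\<^sup>2 * (2 * r * p + r * q)"
    by (simp add: power2_eq_square power3_eq_cube algebra_simps)
  finally show ?thesis
    using assms by simp
qed

theorem theorem2:
  fixes a b t A G L :: real
  assumes "a > 0" and "b > 0" and "a \<noteq> b"
    and "A = arith_mean a b" and "G = geom_mean a b" and "L = log_mean a b"
    and "t > 0"
  shows "L powr (2 * t) * A powr t + L powr t * G powr (2 * t)
           > 2 * A powr t * G powr (2 * t)
       \<and> 2 * L powr t * A powr t + L powr t * G powr t
           > 3 * A powr t * G powr t"
proof -
  have A: "A > 0" and G: "G > 0"
    using assms by (simp_all add: arith_mean_def geom_mean_def)
  have L: "L > 0" and less: "A * G\<^sup>2 < L ^ 3"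
    using arith_geom_less_log_mean_cube[of a b] assms by simp_all
  have powr_double: "y powr (2 * t) = (y powr t)\<^sup>2" if "y > 0" for y
    using that by (simp add: powr_power mult.commute)
  \<comment> \<open>The cubic inequality is between monomials, so it survives raising to the power
    \<open>t\<close>; this reduces every \<open>t > 0\<close> to the two polynomial lemmas at
    \<open>A powr t\<close>, \<open>G powr t\<close>, \<open>L powr t\<close>.\<close>
  have "(A * G\<^sup>2) powr t < (L ^ 3) powr t"
    using less A \<open>t > 0\<close> by (intro powr_less_mono2) auto
  also have "(A * G\<^sup>2) powr t = A powr t * (G powr t)\<^sup>2"
    using A G by (simp add: powr_mult power2_eq_square)
  also have "(L ^ 3) powr t = (L powr t) ^ 3"
    using L by (simp add: powr_mult power3_eq_cube)
  finally have "A powr t * (G powr t)\<^sup>2 < (L powr t) ^ 3" .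
  then show ?thesis
    using two_mult_less_of_mult_square_less_cube[of "A powr t" "G powr t" "L powr t"]
      three_mult_less_of_mult_square_less_cube[of "A powr t" "G powr t" "L powr t"] A G L
    by (simp add: powr_double)
qed

end
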